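(* Let $X=\{P_1,\dots,P_r\}$ be a set of $r$ distinct points of $\mathbb P^n_{\mathbf k}$, not contained in a hyperplane, and let $L_1,\dots,L_r$ be the associated linear forms. Given an integer $u\ge1$ and $\alpha_1,\dots,\alpha_r\in\mathbf k^*$, consider the $R$-submodule $M$ of $\Gamma$ generated by the elements $$F_t:=\frac1{(t+u)!}\sum_{i=1}^r\alpha_iL_i^{t+u},\qquad t\ge1.$$ Then: (1) $M=\langle L_1^t,\dots,L_r^t;\ t\ge1\rangle$; (2) $I(X)=\operatorname{Ann}_R(M)$.
   Context: $\mathbf k$ is an algebraically closed field of characteristic zero, $n\ge1$, $R=\mathbf k[x_0,\dots,x_n]$ and $\Gamma=\mathbf k[y_0,\dots,y_n]$. $R$ acts on $\Gamma$ by differentiation: $f\circ g=f(\partial_{y_0},\dots,\partial_{y_n})(g)$, making $\Gamma$ an $R$-module. $\langle G_j\rangle$ denotes the $R$-submodule of $\Gamma$ generated by elements $G_j$; for a submodule $W$, $\operatorname{Ann}_R(W)=\{g\in R: g\circ G=0\ \forall G\in W\}$. $I(X)\subset R$ is the homogeneous ideal of $X$. The linear form associated to $P=[a_0,\dots,a_n]$ is $L=a_0y_0+\cdots+a_ny_n\in\Gamma$ (for a fixed choice of homogeneous coordinates). *)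

theory Defs
  imports
    "HOL-Analysis.Finite_Cartesian_Product"
    "HOL-Computational_Algebra.Polynomial"
    "HOL-Library.Poly_Mapping"
begin

text \<open>
  The polynomial ring over \<open>'k\<close> in variables indexed by the finite type \<open>'v\<close>: finitely supported
  maps from exponents to coefficients, multiplied by convolution. For \<open>CARD('v) = n + 1\<close> this type
  serves both as \<open>k[x\<^sub>0,\<dots>,x\<^sub>n]\<close> and as \<open>k[y\<^sub>0,\<dots>,y\<^sub>n]\<close>.
\<close>

type_synonym ('v, 'k) mpol = "('v \<Rightarrow>\<^sub>0 nat) \<Rightarrow>\<^sub>0 'k"

definition Const :: "'k \<Rightarrow> ('v, 'k::comm_ring_1) mpol" where
  "Const c = Poly_Mapping.single 0 c"

definition Var :: "'v \<Rightarrow> ('v, 'k::comm_ring_1) mpol" where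
  "Var v = Poly_Mapping.single (Poly_Mapping.single v 1) 1"

definition peval :: "('v::finite, 'k::comm_ring_1) mpol \<Rightarrow> 'k ^ 'v \<Rightarrow> 'k" where
  "peval f a = (\<Sum>m\<in>Poly_Mapping.keys f.
      Poly_Mapping.lookup f m * (\<Prod>v\<in>UNIV. (a $ v) ^ Poly_Mapping.lookup m v))"

definition homogeneous :: "nat \<Rightarrow> ('v::finite, 'k::comm_ring_1) mpol \<Rightarrow> bool" where
  "homogeneous d f \<longleftrightarrow>
     (\<forall>m\<in>Poly_Mapping.keys f. (\<Sum>v\<in>UNIV. Poly_Mapping.lookup m v) = d)"


subsection \<open>The action by differentiation\<close>

text \<open>In a term with \<open>lookup m v = 0\<close> the subtraction of exponents truncates, but there the
  coefficient is zero.\<close>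

definition partial_deriv :: "'v \<Rightarrow> ('v, 'k::comm_ring_1) mpol \<Rightarrow> ('v, 'k) mpol" where
  "partial_deriv v g = (\<Sum>m\<in>Poly_Mapping.keys g.
      Poly_Mapping.single (m - Poly_Mapping.single v 1)
        (of_nat (Poly_Mapping.lookup m v) * Poly_Mapping.lookup g m))"

text \<open>The composition of the powers \<open>partial_deriv v ^^ lookup m v\<close> over all variables \<open>v\<close>; the
  order is irrelevant by \<open>comp_fun_commute_partial_deriv\<close> below.\<close>

definition monom_deriv :: "('v::finite \<Rightarrow>\<^sub>0 nat) \<Rightarrow> ('v, 'k::comm_ring_1) mpol \<Rightarrow> ('v, 'k) mpol" where
  "monom_deriv m g = Finite_Set.fold (\<lambda>v. partial_deriv v ^^ Poly_Mapping.lookup m v) g UNIV"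

definition diff_act :: "('v::finite, 'k::comm_ring_1) mpol \<Rightarrow> ('v, 'k) mpol \<Rightarrow> ('v, 'k) mpol"
    (infixr \<open>\<odot>\<close> 75) where
  "f \<odot> g = (\<Sum>m\<in>Poly_Mapping.keys f. Const (Poly_Mapping.lookup f m) * monom_deriv m g)"

lemma lookup_Const_mult:
  "Poly_Mapping.lookup (Const c * g) e = c * Poly_Mapping.lookup g e"
proof -
  have "Poly_Mapping.lookup (Const c * g) e
      = (\<Sum>l. c * (\<Sum>q. Poly_Mapping.lookup g q when e = l + q) when l = 0)"
    unfolding Const_def lookup_mult
    by (intro Sum_any.cong) (auto simp: lookup_single when_def)
  then show ?thesis by simp
qed

lemma lookup_partial_deriv:
  "Poly_Mapping.lookup (partial_deriv v g) e =
     of_nat (Poly_Mapping.lookup e v + 1) * Poly_Mapping.lookup g (e + Poly_Mapping.single v 1)"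
proof -
  have eq: "Poly_Mapping.lookup (Poly_Mapping.single (m - Poly_Mapping.single v 1)
          (of_nat (Poly_Mapping.lookup m v) * Poly_Mapping.lookup g m)) e
      = (if m = e + Poly_Mapping.single v 1
         then of_nat (Poly_Mapping.lookup m v) * Poly_Mapping.lookup g m else 0)" for m
  proof (cases "Poly_Mapping.lookup m v = 0")
    case True
    then show ?thesis by (auto simp: lookup_single when_def)
  next
    case False
    then have "m - Poly_Mapping.single v 1 = e \<longleftrightarrow> m = e + Poly_Mapping.single v 1"
      by (auto simp: poly_mapping_eq_iff fun_eq_iff lookup_add lookup_minus lookup_single when_def)
    then show ?thesis by (auto simp: lookup_single when_def)
  qed
  show ?thesis
    unfolding partial_deriv_def lookup_sum eq
    by (simp add: lookup_add in_keys_iff)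
qed

lemma partial_deriv_commute:
  "partial_deriv v (partial_deriv w g) = partial_deriv w (partial_deriv v g)"
  by (cases "v = w")
     (auto intro!: poly_mapping_eqI
        simp: lookup_partial_deriv lookup_add lookup_single when_def algebra_simps)

lemma partial_deriv_add: "partial_deriv v (g + h) = partial_deriv v g + partial_deriv v h"
  by (auto intro!: poly_mapping_eqI simp: lookup_partial_deriv lookup_add algebra_simps)

lemma partial_deriv_Const_mult: "partial_deriv v (Const c * g) = Const c * partial_deriv v g"
  by (rule poly_mapping_eqI) (simp add: lookup_partial_deriv lookup_Const_mult mult.left_commute)

lemma funpow_commute_apply:
  assumes "\<And>x. h (f x) = f (h x)"
  shows "h ((f ^^ k) x) = (f ^^ k) (h x)"
  by (induction k) (simp_all add: assms)

lemma comp_fun_commute_partial_deriv: "comp_fun_commute (\<lambda>v. partial_deriv v ^^ k v)"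
proof
  fix v w
  show "(partial_deriv w ^^ k w) \<circ> (partial_deriv v ^^ k v)
      = (partial_deriv v ^^ k v) \<circ> (partial_deriv w ^^ k w)"
    by (auto intro!: funpow_commute_apply funpow_commute_apply[symmetric] partial_deriv_commute)
qed

lemma fold_partial_deriv_insert:
  assumes "finite A" "v \<notin> A"
  shows "Finite_Set.fold (\<lambda>v. partial_deriv v ^^ k v) g (insert v A)
       = (partial_deriv v ^^ k v) (Finite_Set.fold (\<lambda>v. partial_deriv v ^^ k v) g A)"
proof -
  interpret comp_fun_commute "\<lambda>v. partial_deriv v ^^ k v"
    by (rule comp_fun_commute_partial_deriv)
  show ?thesis using assms by (intro fold_insert) auto
qed

lemma fold_partial_deriv_commute:
  fixes h :: "('v, 'k::comm_ring_1) mpol \<Rightarrow> ('v, 'k) mpol"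
  assumes "finite A" "\<And>v x. h (partial_deriv v x) = partial_deriv v (h x)"
  shows "h (Finite_Set.fold (\<lambda>v. partial_deriv v ^^ k v) g A)
       = Finite_Set.fold (\<lambda>v. partial_deriv v ^^ k v) (h g) A"
proof -
  have "h ((partial_deriv v ^^ j) x) = (partial_deriv v ^^ j) (h x)" for v j x
    by (rule funpow_commute_apply) (rule assms(2))
  with assms(1) show ?thesis
    by (induction A) (simp_all add: fold_partial_deriv_insert)
qed

lemma monom_deriv_Const_mult: "monom_deriv m (Const c * g) = Const c * monom_deriv m g"
  unfolding monom_deriv_def
  by (rule fold_partial_deriv_commute[symmetric]) (simp_all add: partial_deriv_Const_mult)

lemma monom_deriv_add: "monom_deriv m (g + h) = monom_deriv m g + monom_deriv m h"
proof -
  have pow: "(partial_deriv v ^^ j) (x + y) = (partial_deriv v ^^ j) x + (partial_deriv v ^^ j) y"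
    for v :: 'a and j and x y :: "('a, 'b) mpol"
    by (induction j) (simp_all add: partial_deriv_add)
  have "Finite_Set.fold (\<lambda>v. partial_deriv v ^^ k v) (g + h) A
     = Finite_Set.fold (\<lambda>v. partial_deriv v ^^ k v) g A
       + Finite_Set.fold (\<lambda>v. partial_deriv v ^^ k v) h A" if "finite A" for A k
    using that by (induction A) (simp_all add: fold_partial_deriv_insert pow)
  then show ?thesis by (simp add: monom_deriv_def)
qed

lemma monom_deriv_0: "monom_deriv 0 g = g"
proof -
  have "Finite_Set.fold (\<lambda>v. partial_deriv v ^^ 0) g A = g" if "finite A" for A
    using that
  proof (induction A)
    case (insert v A)
    have "Finite_Set.fold (\<lambda>v. partial_deriv v ^^ 0) g (insert v A)
        = (partial_deriv v ^^ 0) (Finite_Set.fold (\<lambda>v. partial_deriv v ^^ 0) g A)"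
      by (rule fold_partial_deriv_insert[OF insert(1,2)])
    also have "\<dots> = g" unfolding insert.IH by simp
    finally show ?case .
  qed simp
  from this[of UNIV] show ?thesis by (simp add: monom_deriv_def)
qed

lemma monom_deriv_plus: "monom_deriv (m + m') g = monom_deriv m (monom_deriv m' g)"
proof -
  have "Finite_Set.fold (\<lambda>v. partial_deriv v ^^ (k v + l v)) g A
     = Finite_Set.fold (\<lambda>v. partial_deriv v ^^ k v)
         (Finite_Set.fold (\<lambda>v. partial_deriv v ^^ l v) g A) A" if "finite A" for A k l
    using that
  proof (induction A)
    case (insert v A)
    have comm: "(partial_deriv v ^^ l v) (Finite_Set.fold (\<lambda>v. partial_deriv v ^^ k v) x A)
        = Finite_Set.fold (\<lambda>v. partial_deriv v ^^ k v) ((partial_deriv v ^^ l v) x) A" for x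
      by (rule fold_partial_deriv_commute[OF insert(1)])
         (simp add: funpow_commute_apply partial_deriv_commute)
    have "Finite_Set.fold (\<lambda>v. partial_deriv v ^^ (k v + l v)) g (insert v A)
        = (partial_deriv v ^^ (k v + l v))
            (Finite_Set.fold (\<lambda>v. partial_deriv v ^^ (k v + l v)) g A)"
      by (rule fold_partial_deriv_insert[OF insert(1,2)])
    also have "\<dots> = (partial_deriv v ^^ k v) ((partial_deriv v ^^ l v)
            (Finite_Set.fold (\<lambda>v. partial_deriv v ^^ k v)
              (Finite_Set.fold (\<lambda>v. partial_deriv v ^^ l v) g A) A))"
      unfolding insert.IH by (simp add: funpow_add)
    finally show ?case
      by (simp only: comm fold_partial_deriv_insert[OF insert(1,2)])
  qed simp
  then show ?thesis by (simp add: monom_deriv_def lookup_add)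
qed

lemma Const_simps:
  "Const 0 = 0" "Const 1 = 1" "Const (c + d) = Const c + Const d" "Const (c * d) = Const c * Const d"
  by (simp_all add: Const_def single_add mult_single)

lemma diff_act_superset:
  assumes "finite A" "Poly_Mapping.keys f \<subseteq> A"
  shows "f \<odot> g = (\<Sum>m\<in>A. Const (Poly_Mapping.lookup f m) * monom_deriv m g)"
  unfolding diff_act_def using assms
  by (intro sum.mono_neutral_left) (auto simp: in_keys_iff Const_simps)

lemma diff_act_single: "Poly_Mapping.single m c \<odot> g = Const c * monom_deriv m g"
  by (subst diff_act_superset[of "{m}"]) (auto simp: Const_simps)

lemma diff_act_add_left: "(f + f') \<odot> g = f \<odot> g + f' \<odot> g"
proof -
  let ?A = "Poly_Mapping.keys f \<union> Poly_Mapping.keys f'"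
  have "finite ?A" by simp
  then show ?thesis
    using Poly_Mapping.keys_add[of f f']
    by (simp add: diff_act_superset[of ?A] lookup_add Const_simps distrib_right sum.distrib)
qed

lemma diff_act_add_right: "f \<odot> (g + h) = f \<odot> g + f \<odot> h"
  by (simp add: diff_act_def monom_deriv_add distrib_left sum.distrib)

lemma mpol_induct [case_names zero single add]:
  fixes f :: "('v, 'k::comm_ring_1) mpol"
  assumes "Q 0" "\<And>m c. Q (Poly_Mapping.single m c)" "\<And>f g. Q f \<Longrightarrow> Q g \<Longrightarrow> Q (f + g)"
  shows "Q f"
proof -
  have "Q (\<Sum>m\<in>A. Poly_Mapping.single m (Poly_Mapping.lookup f m))" if "finite A" for A
    using that by (induction A) (auto intro: assms)
  moreover have "f = (\<Sum>m\<in>Poly_Mapping.keys f. Poly_Mapping.single m (Poly_Mapping.lookup f m))"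
    by (auto intro!: poly_mapping_eqI simp: lookup_sum lookup_single when_def in_keys_iff)
  ultimately show ?thesis by (metis finite_keys)
qed

lemma diff_act_zero_left: "0 \<odot> g = 0"
  by (simp add: diff_act_def)

lemma diff_act_zero_right: "f \<odot> 0 = 0"
  using diff_act_add_right[of f 0 0] by simp

lemma diff_act_mult: "f \<odot> (f' \<odot> g) = (f * f') \<odot> g"
proof (induction f rule: mpol_induct)
  case (single m c)
  show ?case
  proof (induction f' rule: mpol_induct)
    case (single m' c')
    then show ?case
      by (simp add: diff_act_single mult_single monom_deriv_Const_mult monom_deriv_plus Const_simps
          mult.assoc)
  qed (simp_all add: diff_act_zero_left diff_act_zero_right diff_act_add_left diff_act_add_right
      distrib_left)
qed (simp_all add: diff_act_zero_left diff_act_add_left distrib_right)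

theorem module_diff_act: "module (diff_act :: ('v::finite, 'k::comm_ring_1) mpol \<Rightarrow> _)"
proof
  show "1 \<odot> g = g" for g :: "('v, 'k) mpol"
    using diff_act_single[of 0 1 g] by (simp add: monom_deriv_0 Const_simps)
qed (simp_all add: diff_act_add_right diff_act_add_left diff_act_mult)

abbreviation generated_submodule :: "('v::finite, 'k::comm_ring_1) mpol set \<Rightarrow> ('v, 'k) mpol set" where
  "generated_submodule \<equiv> module.span diff_act"

definition Ann :: "('v::finite, 'k::comm_ring_1) mpol set \<Rightarrow> ('v, 'k) mpol set" where
  "Ann W = {g. \<forall>G\<in>W. g \<odot> G = 0}"


subsection \<open>Projective space\<close>

text \<open>A point is the set of all its homogeneous coordinate vectors.\<close>

definition proj_rel :: "(('k::field ^ 'v::finite) \<times> ('k ^ 'v)) set" where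
  "proj_rel = {(a, b). a \<noteq> 0 \<and> b \<noteq> 0 \<and> (\<exists>c. c \<noteq> 0 \<and> b = c *s a)}"

definition proj_space :: "('k::field ^ 'v::finite) set set" where
  "proj_space = (UNIV - {0}) // proj_rel"

lemma equiv_proj_rel: "equiv (UNIV - {0}) (proj_rel :: (('k::field ^ 'v::finite) \<times> ('k ^ 'v)) set)"
proof (rule equivI)
  show "refl_on (UNIV - {0}) (proj_rel :: (('k ^ 'v) \<times> ('k ^ 'v)) set)"
    by (auto simp: refl_on_def proj_rel_def intro!: exI[of _ 1])
  show "sym (proj_rel :: (('k ^ 'v) \<times> ('k ^ 'v)) set)"
  proof (rule symI)
    fix a b :: "'k ^ 'v"
    assume "(a, b) \<in> proj_rel"
    then obtain c where "a \<noteq> 0" "b \<noteq> 0" "c \<noteq> 0" "b = c *s a" by (auto simp: proj_rel_def)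
    then show "(b, a) \<in> proj_rel"
      by (auto simp: proj_rel_def vector_smult_assoc intro!: exI[of _ "inverse c"])
  qed
  show "trans (proj_rel :: (('k ^ 'v) \<times> ('k ^ 'v)) set)"
    by (rule transI) (auto simp: proj_rel_def vector_smult_assoc; metis mult_eq_0_iff)
qed (auto simp: proj_rel_def)

definition is_hyperplane :: "('k::field ^ 'v::finite) set set \<Rightarrow> bool" where
  "is_hyperplane H \<longleftrightarrow>
     (\<exists>c. c \<noteq> 0 \<and> H = {p \<in> proj_space. \<forall>a\<in>p. (\<Sum>v\<in>UNIV. c $ v * a $ v) = 0})"

text \<open>The span with respect to multiplication is the generated ideal.\<close>

definition vanishing_ideal :: "('k::field ^ 'v::finite) set set \<Rightarrow> ('v, 'k) mpol set" where
  "vanishing_ideal X =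
     module.span (*) {f. (\<exists>d. homogeneous d f) \<and> (\<forall>p\<in>X. \<forall>a\<in>p. peval f a = 0)}"

definition assoc_linear_form :: "'k::comm_ring_1 ^ 'v::finite \<Rightarrow> ('v, 'k) mpol" where
  "assoc_linear_form a = (\<Sum>v\<in>UNIV. Const (a $ v) * Var v)"

end

theory Submission
  imports Defs
begin

text \<open>
  Put \<open>D\<^sub>k(a) = L\<^sub>a\<^sup>k / k!\<close>. Differentiation lowers these divided powers, so a form \<open>f\<close> of degree \<open>d\<close>
  satisfies \<open>f \<odot> D\<^sub>k\<^sub>+\<^sub>d(a) = f(a) D\<^sub>k(a)\<close>. For (1), a product of linear forms that vanishes at all
  points except \<open>P\<^sub>j\<close>, of degree \<open>d \<ge> u\<close>, maps \<open>F\<^sub>t\<^sub>+\<^sub>d\<^sub>-\<^sub>u\<close> to a nonzero multiple of \<open>D\<^sub>t(a\<^sub>j)\<close>. For (2), if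
  \<open>g\<close> kills \<open>D\<^sub>t(a)\<close> and \<open>a\<^sub>v \<noteq> 0\<close>, then the coefficient of \<open>y\<^sub>v\<^sup>t\<^sup>-\<^sup>d\<close> in \<open>g \<odot> D\<^sub>t(a)\<close> shows that the
  component of \<open>g\<close> of degree \<open>d \<le> t\<close> vanishes at \<open>a\<close>.
\<close>

section \<open>Rules of calculus for the action by differentiation\<close>

abbreviation mdeg :: "('v::finite \<Rightarrow>\<^sub>0 nat) \<Rightarrow> nat" where
  "mdeg m \<equiv> (\<Sum>v\<in>UNIV. Poly_Mapping.lookup m v)"

abbreviation monom_eval :: "('v::finite \<Rightarrow>\<^sub>0 nat) \<Rightarrow> 'k::comm_ring_1 ^ 'v \<Rightarrow> 'k" where
  "monom_eval m a \<equiv> (\<Prod>v\<in>UNIV. (a $ v) ^ Poly_Mapping.lookup m v)"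

interpretation diff_act: module "diff_act :: ('v::finite, 'k::comm_ring_1) mpol \<Rightarrow> _"
  by (rule module_diff_act)

text \<open>With the ring as a module over itself, subspaces are ideals and the span in
  \<open>vanishing_ideal\<close> becomes accessible to the module lemmas.\<close>

interpretation mpol_mult: module "(*) :: ('v, 'k::comm_ring_1) mpol \<Rightarrow> _"
  by unfold_locales (simp_all add: algebra_simps)

text \<open>As simp rules these would merge nested products and actions, against
  \<open>mult.assoc\<close> and the flipped \<open>diff_act_mult\<close> used below.\<close>

declare diff_act.scale_scale [simp del] mpol_mult.scale_scale [simp del]

lemma Const_diff_act: "Const c \<odot> g = Const c * g"
  by (simp add: Const_def[of c] diff_act_single monom_deriv_0)

text \<open>Multiplying by a constant is itself the action of a ring element, so commutativity of
  the ring gives linearity over the field.\<close>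

lemma diff_act_Const_mult: "f \<odot> (Const c * g) = Const c * (f \<odot> g)"
  by (metis Const_diff_act diff_act_mult mult.commute)

lemma Const_mult_eq_0_iff:
  fixes g :: "('v, 'k::field) mpol"
  assumes "c \<noteq> 0"
  shows "Const c * g = 0 \<longleftrightarrow> g = 0"
proof
  assume "Const c * g = 0"
  then have "Const (inverse c) * (Const c * g) = 0" by simp
  then show "g = 0" using assms by (simp add: mult.assoc[symmetric] Const_simps(4)[symmetric] Const_simps(2))
qed simp

lemma monom_deriv_single: "monom_deriv (Poly_Mapping.single v 1) g = partial_deriv v g"
proof -
  have *: "Finite_Set.fold (\<lambda>w. partial_deriv w ^^ Poly_Mapping.lookup (Poly_Mapping.single v 1) w) g A
      = (if v \<in> A then partial_deriv v g else g)" if "finite A" for A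
    using that
  proof (induction A)
    case (insert w A)
    show ?case
      unfolding fold_partial_deriv_insert[OF insert(1,2)] insert.IH
      using insert(2) by (auto simp: lookup_single when_def)
  qed simp
  show ?thesis using *[of UNIV] by (simp add: monom_deriv_def)
qed

lemma Var_diff_act: "Var v \<odot> g = partial_deriv v g"
  unfolding Var_def diff_act_single monom_deriv_single by (simp add: Const_simps)

lemma partial_deriv_0: "partial_deriv v 0 = 0"
  by (simp add: partial_deriv_def)

lemma partial_deriv_single:
  "partial_deriv v (Poly_Mapping.single m c)
     = Poly_Mapping.single (m - Poly_Mapping.single v 1) (of_nat (Poly_Mapping.lookup m v) * c)"
  by (cases "c = 0") (simp_all add: partial_deriv_def)

lemma partial_deriv_sum: "partial_deriv v (sum g A) = (\<Sum>x\<in>A. partial_deriv v (g x))"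
  by (induction A rule: infinite_finite_induct) (simp_all add: partial_deriv_0 partial_deriv_add)

text \<open>Both sides are additive in each factor, so monomials suffice.\<close>

lemma partial_deriv_mult:
  "partial_deriv v (f * g) = partial_deriv v f * g + f * partial_deriv v g"
proof (induction f rule: mpol_induct)
  case (single m c)
  show ?case
  proof (induction g rule: mpol_induct)
    case (single m' c')
    let ?v = "Poly_Mapping.single v (1::nat)"
    \<comment> \<open>Subtraction of exponents truncates, so the shift requires a positive exponent
      of \<open>v\<close>; if the exponent is 0, the coefficients in \<open>left\<close> and
      \<open>right\<close> are 0 instead.\<close>
    have shift: "(l + l' - ?v) = (l - ?v) + l'" if "Poly_Mapping.lookup l v \<noteq> 0" for l l'
      using that by (auto intro!: poly_mapping_eqI simp: lookup_add lookup_minus lookup_single when_def)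
    have left: "Poly_Mapping.single (m + m' - ?v) (of_nat (Poly_Mapping.lookup m v) * c * c')
        = Poly_Mapping.single (m - ?v + m') (of_nat (Poly_Mapping.lookup m v) * c * c')"
      using shift[of m m'] by (cases "Poly_Mapping.lookup m v = 0") simp_all
    have right: "Poly_Mapping.single (m + m' - ?v) (of_nat (Poly_Mapping.lookup m' v) * c * c')
        = Poly_Mapping.single (m + (m' - ?v)) (of_nat (Poly_Mapping.lookup m' v) * c * c')"
      using shift[of m' m] by (cases "Poly_Mapping.lookup m' v = 0") (simp_all add: add.commute)
    have "partial_deriv v (Poly_Mapping.single m c * Poly_Mapping.single m' c')
        = Poly_Mapping.single (m + m' - ?v) (of_nat (Poly_Mapping.lookup m v) * c * c')
          + Poly_Mapping.single (m + m' - ?v) (of_nat (Poly_Mapping.lookup m' v) * c * c')"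
      by (simp add: mult_single partial_deriv_single lookup_add algebra_simps flip: single_add)
    then show ?case
      unfolding left right by (simp add: mult_single partial_deriv_single ac_simps)
  qed (simp_all add: partial_deriv_0 partial_deriv_add algebra_simps)
qed (simp_all add: partial_deriv_0 partial_deriv_add algebra_simps)

lemma partial_deriv_Var: "partial_deriv v (Var w) = (if v = w then 1 else 0)"
  by (simp add: Var_def partial_deriv_single lookup_single when_def)

lemma partial_deriv_assoc_linear_form: "partial_deriv v (assoc_linear_form a) = Const (a $ v)"
proof -
  have "partial_deriv v (assoc_linear_form a) = (\<Sum>w\<in>UNIV. if w = v then Const (a $ w) else 0)"
    unfolding assoc_linear_form_def partial_deriv_sum partial_deriv_Const_mult partial_deriv_Var
    by (intro sum.cong) auto
  then show ?thesis by simp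
qed

lemma partial_deriv_assoc_linear_form_power:
  "partial_deriv v (assoc_linear_form a ^ Suc k)
     = Const (of_nat (Suc k) * a $ v) * assoc_linear_form a ^ k"
proof (induction k)
  case 0
  then show ?case by (simp add: partial_deriv_assoc_linear_form)
next
  case (Suc k)
  have "Const (of_nat (Suc (Suc k)) * a $ v) = Const (a $ v) + Const (of_nat (Suc k) * a $ v)"
    by (simp add: algebra_simps flip: Const_simps)
  moreover have "partial_deriv v (assoc_linear_form a ^ Suc (Suc k))
      = (Const (a $ v) + Const (of_nat (Suc k) * a $ v)) * assoc_linear_form a ^ Suc k"
    unfolding power_Suc[of _ "Suc k"] partial_deriv_mult Suc.IH partial_deriv_assoc_linear_form
    by (simp add: distrib_left distrib_right mult.left_commute)
  ultimately show ?case by metis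
qed


subsection \<open>Divided powers of linear forms\<close>

text \<open>The division absorbs the factor \<open>Suc k\<close> of the power rule, so that a
  derivative only multiplies by a coordinate and lowers the index. The factor in front of
  \<open>F t\<close> is this normalisation.\<close>

definition divided_power :: "'k::field_char_0 ^ 'v::finite \<Rightarrow> nat \<Rightarrow> ('v, 'k) mpol" where
  "divided_power a k = Const (1 / fact k) * assoc_linear_form a ^ k"

lemma linear_form_power_eq_divided_power:
  "assoc_linear_form a ^ k = Const (fact k) * divided_power a k"
  by (simp add: divided_power_def mult.assoc[symmetric] Const_simps(4)[symmetric] Const_simps(2))

lemma divided_power_0: "divided_power a 0 = 1"
  by (simp add: divided_power_def Const_simps)

lemma partial_deriv_divided_power_0:
  fixes a :: "'k::field_char_0 ^ 'v::finite"
  shows "partial_deriv v (divided_power a 0) = 0"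
proof -
  have "partial_deriv v (Poly_Mapping.single 0 1) = (0 :: ('v, 'k) mpol)"
    by (simp only: partial_deriv_single) simp
  then show ?thesis by (simp add: divided_power_0)
qed

lemma partial_deriv_divided_power_Suc:
  "partial_deriv v (divided_power a (Suc k)) = Const (a $ v) * divided_power a k"
proof -
  have "1 / fact (Suc k) * (of_nat (Suc k) * a $ v) = a $ v * (1 / fact k)"
    by (simp add: field_simps del: of_nat_Suc)
  then show ?thesis
    unfolding divided_power_def partial_deriv_Const_mult partial_deriv_assoc_linear_form_power
    by (simp only: mult.assoc[symmetric] Const_simps(4)[symmetric])
qed

lemma partial_deriv_pow_divided_power:
  "(partial_deriv v ^^ j) (divided_power a k)
     = (if j \<le> k then Const (a $ v ^ j) * divided_power a (k - j) else 0)"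
proof (induction j)
  case 0
  then show ?case by (simp add: Const_simps)
next
  case (Suc j)
  \<comment> \<open>At \<open>j = k\<close> the last derivative meets
    \<open>divided_power a 0\<close>, a constant; from then on everything stays 0.\<close>
  consider "Suc j \<le> k" | "j = k" | "j > k" by linarith
  then show ?case
  proof cases
    case 1
    then have "k - j = Suc (k - Suc j)" by simp
    with 1 Suc show ?thesis
      by (simp add: partial_deriv_Const_mult partial_deriv_divided_power_Suc Const_simps ac_simps)
  next
    case 2
    with Suc show ?thesis by (simp add: partial_deriv_Const_mult partial_deriv_divided_power_0)
  qed (simp add: Suc partial_deriv_0)
qed

text \<open>This is the graded form of the fact that the exponential series of the linear form is a
  common eigenvector of all derivatives, with the coordinates of \<open>a\<close> as
  eigenvalues.\<close>

lemma monom_deriv_divided_power: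
  "monom_deriv m (divided_power a k)
     = (if mdeg m \<le> k then Const (monom_eval m a) * divided_power a (k - mdeg m) else 0)"
proof -
  have zero: "(partial_deriv v ^^ j) 0 = 0" for v :: 'a and j
    by (induction j) (simp_all add: partial_deriv_0)
  have scale: "(partial_deriv v ^^ j) (Const c * g) = Const c * (partial_deriv v ^^ j) g" for v :: 'a and j c g
    by (induction j) (simp_all add: partial_deriv_Const_mult)
  have "Finite_Set.fold (\<lambda>v. partial_deriv v ^^ l v) (divided_power a k) A
      = (if sum l A \<le> k then Const (\<Prod>v\<in>A. (a $ v) ^ l v) * divided_power a (k - sum l A) else 0)"
    if "finite A" for A l
    using that
  proof (induction A)
    case (insert v A)
    show ?case
      unfolding fold_partial_deriv_insert[OF insert(1,2)] insert.IH
      using insert(1,2)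
      by (auto simp: zero scale partial_deriv_pow_divided_power Const_simps add.commute mult.assoc
          mult.left_commute[of "Const (a $ v ^ l v)"])
  qed (simp add: Const_simps)
  then show ?thesis by (simp add: monom_deriv_def)
qed

lemma diff_act_divided_power:
  "f \<odot> divided_power a k = (\<Sum>m\<in>Poly_Mapping.keys f.
     if mdeg m \<le> k
     then Const (Poly_Mapping.lookup f m * monom_eval m a) * divided_power a (k - mdeg m) else 0)"
  unfolding diff_act_def monom_deriv_divided_power
  by (intro sum.cong) (auto simp: Const_simps mult.assoc)

lemma Const_sum: "Const (sum f A) = (\<Sum>x\<in>A. Const (f x))"
  by (induction A rule: infinite_finite_induct) (simp_all add: Const_simps)

text \<open>All monomials of \<open>f\<close> lower the index by the same \<open>d\<close>, so their
  coefficients can be collected, and they add up to the value at \<open>a\<close>.\<close>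

lemma homogeneous_diff_act_divided_power:
  assumes "homogeneous d f"
  shows "f \<odot> divided_power a k = (if d \<le> k then Const (peval f a) * divided_power a (k - d) else 0)"
proof -
  have "f \<odot> divided_power a k = (\<Sum>m\<in>Poly_Mapping.keys f.
     if d \<le> k then Const (Poly_Mapping.lookup f m * monom_eval m a) * divided_power a (k - d) else 0)"
    unfolding diff_act_divided_power using assms
    by (intro sum.cong) (auto simp: homogeneous_def)
  then show ?thesis by (simp add: peval_def Const_sum sum_distrib_right)
qed

lemma lookup_mult_0:
  fixes f g :: "('v, 'k::comm_ring_1) mpol"
  shows "Poly_Mapping.lookup (f * g) 0 = Poly_Mapping.lookup f 0 * Poly_Mapping.lookup g 0"
proof (induction f rule: mpol_induct)
  case (single m c)
  show ?case
  proof (induction g rule: mpol_induct)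
    case (single m' c')
    have "m + m' = 0 \<longleftrightarrow> m = 0 \<and> m' = 0"
      by (auto simp: poly_mapping_eq_iff fun_eq_iff lookup_add)
    then show ?case by (auto simp: mult_single lookup_single when_def)
  qed (simp_all add: lookup_add algebra_simps)
qed (simp_all add: lookup_add algebra_simps)

lemma lookup_divided_power_0: "Poly_Mapping.lookup (divided_power a k) 0 = (if k = 0 then 1 else 0)"
proof (cases k)
  case 0
  then show ?thesis by (simp add: divided_power_0)
next
  case (Suc j)
  have "Poly_Mapping.lookup (Var v :: ('b, 'a) mpol) 0 = 0" for v :: 'b
    by (auto simp: Var_def lookup_single when_def poly_mapping_eq_iff fun_eq_iff)
  then have "Poly_Mapping.lookup (assoc_linear_form a) 0 = 0"
    by (simp add: assoc_linear_form_def lookup_sum lookup_Const_mult)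
  then show ?thesis using Suc
    by (simp add: divided_power_def lookup_Const_mult lookup_mult_0)
qed

text \<open>Differentiating by \<open>v\<close> moves this coefficient to exponent
  \<open>s - 1\<close>, which avoids a multinomial expansion. Characteristic zero allows division by
  \<open>Suc s\<close>.\<close>

lemma lookup_divided_power_single:
  "Poly_Mapping.lookup (divided_power a k) (Poly_Mapping.single v s)
     = (if k = s then a $ v ^ s / fact s else 0)"
proof (induction s arbitrary: k)
  case 0
  then show ?case by (simp add: lookup_divided_power_0)
next
  case (Suc s)
  have "of_nat (Suc s) * Poly_Mapping.lookup (divided_power a k) (Poly_Mapping.single v (Suc s))
      = Poly_Mapping.lookup (partial_deriv v (divided_power a k)) (Poly_Mapping.single v s)"
    by (simp add: lookup_partial_deriv flip: single_add)
  also have "\<dots> = (if k = Suc s then a $ v ^ Suc s / fact s else 0)"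
    by (cases k) (simp_all add: partial_deriv_divided_power_0 partial_deriv_divided_power_Suc
        lookup_Const_mult Suc.IH)
  finally show ?case
    by (simp add: field_simps del: of_nat_Suc split: if_splits)
qed


subsection \<open>Homogeneous components\<close>

definition hom_component :: "nat \<Rightarrow> ('v::finite, 'k::comm_ring_1) mpol \<Rightarrow> ('v, 'k) mpol" where
  "hom_component d f = (\<Sum>m\<in>{m \<in> Poly_Mapping.keys f. mdeg m = d}.
     Poly_Mapping.single m (Poly_Mapping.lookup f m))"

lemma lookup_hom_component:
  "Poly_Mapping.lookup (hom_component d f) m = (if mdeg m = d then Poly_Mapping.lookup f m else 0)"
  by (auto simp: hom_component_def lookup_sum lookup_single when_def in_keys_iff)

lemma keys_hom_component:
  "Poly_Mapping.keys (hom_component d f) = {m \<in> Poly_Mapping.keys f. mdeg m = d}"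
  by (auto simp: in_keys_iff lookup_hom_component split: if_splits)

lemma homogeneous_hom_component: "homogeneous d (hom_component d f)"
  by (simp add: homogeneous_def keys_hom_component)

lemma sum_hom_component: "(\<Sum>d\<in>mdeg ` Poly_Mapping.keys f. hom_component d f) = f"
proof (rule poly_mapping_eqI)
  fix m
  show "Poly_Mapping.lookup (\<Sum>d\<in>mdeg ` Poly_Mapping.keys f. hom_component d f) m = Poly_Mapping.lookup f m"
    by (auto simp: lookup_sum lookup_hom_component in_keys_iff)
qed

text \<open>Monomials of degree other than \<open>d\<close> send
  \<open>divided_power a (d + s)\<close> to a form of degree other than \<open>s\<close> or to 0, so
  one coefficient isolates a single component of an arbitrary \<open>f\<close>.\<close>

lemma lookup_diff_act_divided_power_single:
  "Poly_Mapping.lookup (f \<odot> divided_power a (d + s)) (Poly_Mapping.single v s)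
     = peval (hom_component d f) a * (a $ v ^ s / fact s)"
proof -
  have "Poly_Mapping.lookup (f \<odot> divided_power a (d + s)) (Poly_Mapping.single v s)
      = (\<Sum>m\<in>Poly_Mapping.keys f. if mdeg m = d
          then Poly_Mapping.lookup f m * monom_eval m a * (a $ v ^ s / fact s) else 0)"
    unfolding diff_act_divided_power lookup_sum
    by (intro sum.cong) (auto simp: lookup_Const_mult lookup_divided_power_single)
  also have "\<dots> = (\<Sum>m\<in>{m \<in> Poly_Mapping.keys f. mdeg m = d}.
      Poly_Mapping.lookup f m * monom_eval m a * (a $ v ^ s / fact s))"
    by (rule sum.inter_filter[symmetric]) simp
  also have "\<dots> = peval (hom_component d f) a * (a $ v ^ s / fact s)"
    unfolding peval_def keys_hom_component sum_distrib_right
    by (intro sum.cong) (auto simp: lookup_hom_component)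
  finally show ?thesis .
qed

lemma peval_hom_component_eq_0:
  assumes "a \<noteq> 0" "f \<odot> divided_power a (d + s) = 0"
  shows "peval (hom_component d f) a = 0"
proof -
  obtain v where "a $ v \<noteq> 0" using assms(1) by (auto simp: vec_eq_iff)
  with lookup_diff_act_divided_power_single[of f a d s v] assms(2) show ?thesis by simp
qed

text \<open>Carries vanishing from the chosen coordinate vector of a point to all others, as
  \<open>vanishing_ideal\<close> demands.\<close>

lemma peval_scale:
  assumes "homogeneous d f"
  shows "peval f (c *s a) = c ^ d * peval f a"
  using assms unfolding peval_def sum_distrib_left
  by (intro sum.cong)
     (auto simp: homogeneous_def power_mult_distrib prod.distrib power_sum[symmetric])


subsection \<open>Separating points by products of linear forms\<close>

text \<open>The form is a product of one linear form per element of \<open>A\<close> and the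
  \<open>u\<close>-th power of a variable, hence of degree \<open>u + card A\<close>. Here
  \<open>c\<close> plays the role of evaluation of \<open>f\<close>; only its effect on divided
  powers is recorded.\<close>

lemma exists_separating_form:
  fixes b :: "'k::field_char_0 ^ 'v::finite"
  assumes "finite A" "b \<noteq> 0" "\<And>a. a \<in> A \<Longrightarrow> a \<noteq> 0 \<and> (a, b) \<notin> proj_rel"
  shows "\<exists>f c. c b \<noteq> 0 \<and> (\<forall>a\<in>A. c a = 0) \<and>
    (\<forall>a k. f \<odot> divided_power a (k + (u + card A)) = Const (c a) * divided_power a k)"
  using assms(1,3)
proof (induction A)
  case empty
  \<comment> \<open>A variable not vanishing at \<open>b\<close> supplies the degree
    \<open>u\<close> without destroying \<open>c b \<noteq> 0\<close>.\<close>
  obtain v where v: "b $ v \<noteq> 0" using assms(2) by (auto simp: vec_eq_iff)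
  have "Var v ^ u \<odot> divided_power a (k + u) = Const (a $ v ^ u) * divided_power a k"
    for a :: "'k ^ 'v" and k
  proof (induction u)
    case 0
    then show ?case by simp (simp add: Const_simps)
  next
    case (Suc u)
    then show ?case
      by (simp add: mult.commute[of "Var v"] Var_diff_act partial_deriv_divided_power_Suc
          diff_act_Const_mult Const_simps mult.assoc flip: diff_act_mult)
  qed
  with v show ?case by (intro exI[of _ "Var v ^ u"] exI[of _ "\<lambda>a. a $ v ^ u"]) simp
next
  case (insert e A)
  then obtain f c where f: "c b \<noteq> 0" "\<forall>a\<in>A. c a = 0"
    "\<And>a k. f \<odot> divided_power a (k + (u + card A)) = Const (c a) * divided_power a k"
    by auto
  from insert.prems have e: "e \<noteq> 0" "(e, b) \<notin> proj_rel" by auto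
  then obtain v where v: "e $ v \<noteq> 0" by (auto simp: vec_eq_iff)
  \<comment> \<open>Since \<open>e\<close> and \<open>b\<close> are not proportional, some 2 by 2
    minor of the pair involving the coordinate \<open>v\<close> is nonzero; otherwise
    \<open>b\<close> would be a nonzero multiple of \<open>e\<close>.\<close>
  obtain w where w: "e $ v * b $ w - e $ w * b $ v \<noteq> 0"
  proof (rule ccontr)
    assume "\<not> thesis"
    with that have "e $ v * b $ w = e $ w * b $ v" for w by fastforce
    then have b: "b = (b $ v / e $ v) *s e" using v by (simp add: vec_eq_iff field_simps)
    with \<open>b \<noteq> 0\<close> have "b $ v / e $ v \<noteq> 0" by (metis vector_smult_lzero)
    with b e \<open>b \<noteq> 0\<close> show False unfolding proj_rel_def by blast
  qed
  \<comment> \<open>This minor, with \<open>b\<close> replaced by the variables, is a linear form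
    that vanishes at \<open>e\<close> but not at \<open>b\<close>.\<close>
  define l where "l = Const (e $ v) * Var w + Const (- (e $ w)) * (Var v :: ('v, 'k) mpol)"
  define c' where "c' a = (e $ v * a $ w - e $ w * a $ v) * c a" for a
  have l: "l \<odot> divided_power a (Suc k) = Const (e $ v * a $ w - e $ w * a $ v) * divided_power a k"
    for a k
  proof -
    have "l \<odot> divided_power a (Suc k)
        = (Const (e $ v * a $ w) + Const (- (e $ w) * a $ v)) * divided_power a k"
      unfolding l_def diff_act_add_left diff_act_mult[symmetric] Var_diff_act Const_diff_act
        partial_deriv_divided_power_Suc
      by (simp only: Const_simps distrib_right mult.assoc)
    then show ?thesis by (simp flip: Const_simps)
  qed
  have "(f * l) \<odot> divided_power a (k + (u + card (insert e A))) = Const (c' a) * divided_power a k"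
    for a k
    using insert(1,2) f(3)[of a k]
    by (simp add: l diff_act_Const_mult c'_def Const_simps mult.assoc flip: diff_act_mult)
  moreover have "c' b \<noteq> 0" "\<forall>a\<in>insert e A. c' a = 0"
    using w f by (auto simp: c'_def)
  ultimately show ?case by blast
qed

section \<open>Annihilators and vanishing ideals\<close>

text \<open>By commutativity of the ring, the elements killed by a fixed \<open>g\<close> form a
  submodule.\<close>

lemma Ann_span: "Ann (generated_submodule S) = Ann S"
proof
  show "Ann (generated_submodule S) \<subseteq> Ann S"
    by (auto simp: Ann_def diff_act.span_base)
  show "Ann S \<subseteq> Ann (generated_submodule S)"
  proof
    fix g assume g: "g \<in> Ann S"
    have "diff_act.subspace {G. g \<odot> G = 0}"
      by (auto simp: diff_act.subspace_def diff_act_add_right diff_act_mult mult.commute[of g])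
         (metis diff_act_mult diff_act_zero_right)
    with g have "generated_submodule S \<subseteq> {G. g \<odot> G = 0}"
      by (intro diff_act.span_minimal) (auto simp: Ann_def)
    then show "g \<in> Ann (generated_submodule S)" by (auto simp: Ann_def)
  qed
qed

lemma subspace_Ann: "mpol_mult.subspace (Ann S)"
  by (auto simp: mpol_mult.subspace_def Ann_def diff_act_add_left diff_act_zero_right
      simp flip: diff_act_mult)

lemma subspace_Const_mult:
  "diff_act.subspace S \<Longrightarrow> g \<in> S \<Longrightarrow> Const c * g \<in> S"
  by (metis Const_diff_act diff_act.subspace_scale)

lemma proj_space_member:
  assumes "p \<in> proj_space" "a \<in> p" "b \<in> p"
  shows "(a, b) \<in> proj_rel"
  using assms quotient_eq_iff[OF equiv_proj_rel, of p p a b] by (auto simp: proj_space_def)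

text \<open>An annihilator is an ideal, so one inclusion needs only the homogeneous generators. For
  the other, every homogeneous component of an annihilating \<open>g\<close> is shown to be a
  generator, and \<open>g\<close> is their sum.\<close>

lemma vanishing_ideal_eq_Ann:
  fixes a :: "nat \<Rightarrow> 'k::field_char_0 ^ 'v::finite"
  assumes "\<And>i. i \<in> I \<Longrightarrow> P i \<in> proj_space" "\<And>i. i \<in> I \<Longrightarrow> a i \<in> P i"
  shows "vanishing_ideal (P ` I) = Ann {assoc_linear_form (a i) ^ t | i t. i \<in> I \<and> t \<ge> 1}"
proof
  show "vanishing_ideal (P ` I) \<subseteq> Ann {assoc_linear_form (a i) ^ t | i t. i \<in> I \<and> t \<ge> 1}"
    unfolding vanishing_ideal_def
  proof (rule mpol_mult.span_minimal[OF _ subspace_Ann], rule subsetI)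
    fix f :: "('v, 'k) mpol"
    assume "f \<in> {f. (\<exists>d. homogeneous d f) \<and> (\<forall>p\<in>P ` I. \<forall>a\<in>p. peval f a = 0)}"
    then obtain d where f: "homogeneous d f" "\<And>i. i \<in> I \<Longrightarrow> peval f (a i) = 0"
      using assms by blast
    then show "f \<in> Ann {assoc_linear_form (a i) ^ t | i t. i \<in> I \<and> t \<ge> 1}"
      by (auto simp: Ann_def linear_form_power_eq_divided_power diff_act_Const_mult
          homogeneous_diff_act_divided_power[OF f(1)] Const_simps(1))
  qed
  show "Ann {assoc_linear_form (a i) ^ t | i t. i \<in> I \<and> t \<ge> 1} \<subseteq> vanishing_ideal (P ` I)"
  proof
    fix g assume g: "g \<in> Ann {assoc_linear_form (a i) ^ t | i t. i \<in> I \<and> t \<ge> 1}"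
    have "peval (hom_component d g) b = 0" if i: "i \<in> I" and b: "b \<in> P i" for d i b
    proof -
      obtain c where scaled: "b = c *s a i" and ai: "a i \<noteq> 0"
        using proj_space_member[OF assms(1)[OF i] assms(2)[OF i] b]
        by (auto simp: proj_rel_def)
      \<comment> \<open>The exponent is \<open>d + 1\<close>, not \<open>d\<close>, because the
        powers in the set start at 1 and \<open>d\<close> may be 0.\<close>
      have "g \<odot> assoc_linear_form (a i) ^ (d + 1) = 0"
        using g i by (fastforce simp: Ann_def)
      then have "g \<odot> divided_power (a i) (d + 1) = 0"
        unfolding linear_form_power_eq_divided_power diff_act_Const_mult
        by (simp add: Const_mult_eq_0_iff del: fact_Suc)
      from peval_hom_component_eq_0[OF ai this] show ?thesis
        by (simp add: scaled peval_scale[OF homogeneous_hom_component])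
    qed
    then have "hom_component d g \<in> vanishing_ideal (P ` I)" for d
      unfolding vanishing_ideal_def
      by (intro mpol_mult.span_base) (auto intro: homogeneous_hom_component)
    then have "(\<Sum>d\<in>mdeg ` Poly_Mapping.keys g. hom_component d g) \<in> vanishing_ideal (P ` I)"
      unfolding vanishing_ideal_def by (intro mpol_mult.span_sum)
    then show "g \<in> vanishing_ideal (P ` I)" by (simp add: sum_hom_component)
  qed
qed

section \<open>Equality of the two submodules, and the ideal of the points\<close>

theorem proposition3p6:
  fixes n r u :: nat
    and P :: "nat \<Rightarrow> ('k::{alg_closed_field, field_char_0} ^ 'v::finite) set"
    and a :: "nat \<Rightarrow> 'k ^ 'v"
    and \<alpha> :: "nat \<Rightarrow> 'k"
    and X :: "('k ^ 'v) set set"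
    and L F :: "nat \<Rightarrow> ('v, 'k) mpol"
    and M :: "('v, 'k) mpol set"
  assumes "CARD('v) = n + 1" and "n \<ge> 1"
    and "\<And>i. i \<in> {1..r} \<Longrightarrow> P i \<in> proj_space"
    and "inj_on P {1..r}"
    and "X = P ` {1..r}"
    and "\<not> (\<exists>H. is_hyperplane H \<and> X \<subseteq> H)"
    and "\<And>i. i \<in> {1..r} \<Longrightarrow> a i \<in> P i"
    and "\<And>i. L i = assoc_linear_form (a i)"
    and "u \<ge> 1"
    and "\<And>i. i \<in> {1..r} \<Longrightarrow> \<alpha> i \<noteq> 0"
    and "\<And>t. F t = Const (1 / fact (t + u)) * (\<Sum>i=1..r. Const (\<alpha> i) * L i ^ (t + u))"
    and "M = generated_submodule {F t | t. t \<ge> 1}"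
  shows "M = generated_submodule {L i ^ t | i t. i \<in> {1..r} \<and> t \<ge> 1}
       \<and> vanishing_ideal X = Ann M"
proof -
  note P = assms(3) and inj = assms(4) and a = assms(7) and L = assms(8)
  let ?N = "{L i ^ t | i t. i \<in> {1..r} \<and> t \<ge> 1}"
  have subM: "diff_act.subspace M" unfolding assms(12) by (rule diff_act.subspace_span)
  have F: "F t = (\<Sum>i=1..r. Const (\<alpha> i) * divided_power (a i) (t + u))" for t
    unfolding assms(11) L divided_power_def sum_distrib_left by (simp add: ac_simps)
  have "M \<subseteq> generated_submodule ?N"
    unfolding assms(12)
  proof (rule diff_act.span_minimal[OF _ diff_act.subspace_span], clarify)
    fix t :: nat assume "t \<ge> 1"
    then have "L i ^ (t + u) \<in> generated_submodule ?N" if "i \<in> {1..r}" for i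
      using that by (intro diff_act.span_base) fastforce
    then show "F t \<in> generated_submodule ?N"
      unfolding assms(11)
      by (intro subspace_Const_mult diff_act.subspace_span diff_act.span_sum)
  qed
  moreover have "L j ^ t \<in> M" if j: "j \<in> {1..r}" and t: "t \<ge> 1" for j t
  proof -
    let ?A = "a ` ({1..r} - {j})"
    \<comment> \<open>A coordinate vector is related to itself, and \<open>proj_rel\<close> relates
      only nonzero vectors.\<close>
    have nz: "a i \<noteq> 0" if "i \<in> {1..r}" for i
      using proj_space_member[OF P a a] that by (force simp: proj_rel_def)
    \<comment> \<open>Proportional coordinate vectors would give the same class, against injectivity
      of \<open>P\<close>.\<close>
    have "(a i, a j) \<notin> proj_rel" if i: "i \<in> {1..r} - {j}" for i
    proof
      assume "(a i, a j) \<in> proj_rel"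
      then have "P i = P j"
        using quotient_eq_iff[OF equiv_proj_rel, of "P i" "P j" "a i" "a j"] P a i j
        by (auto simp: proj_space_def)
      with inj i j show False by (auto dest: inj_onD)
    qed
    with nz have "e \<noteq> 0 \<and> (e, a j) \<notin> proj_rel" if "e \<in> ?A" for e
      using that by (metis DiffD1 imageE)
    then obtain f c where f: "c (a j) \<noteq> 0" "\<forall>e\<in>?A. c e = 0"
      "\<And>e k. f \<odot> divided_power e (k + (u + card ?A)) = Const (c e) * divided_power e k"
      using exists_separating_form[of ?A "a j" u] nz[OF j] by blast
    \<comment> \<open>The divided powers in \<open>F (t + card ?A)\<close> have index
      \<open>t + card ?A + u\<close>; lowering by \<open>u + card ?A\<close> leaves exactly
      \<open>t\<close>, and only the \<open>j\<close>-th summand survives.\<close>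
    have "f \<odot> F (t + card ?A) = (\<Sum>i=1..r. Const (\<alpha> i) * (f \<odot> divided_power (a i) (t + (u + card ?A))))"
      unfolding F diff_act.scale_sum_right diff_act_Const_mult by (simp add: ac_simps)
    also have "\<dots> = (\<Sum>i=1..r. if i = j then Const (\<alpha> j * c (a j)) * divided_power (a j) t else 0)"
      unfolding f(3) using f(2) by (intro sum.cong) (auto simp: Const_simps mult.assoc)
    also have "\<dots> = Const (\<alpha> j * c (a j)) * divided_power (a j) t"
      using j by simp
    finally have act: "f \<odot> F (t + card ?A) = Const (\<alpha> j * c (a j)) * divided_power (a j) t" .
    have "F (t + card ?A) \<in> M" unfolding assms(12) using t by (intro diff_act.span_base) auto
    then have "Const (\<alpha> j * c (a j)) * divided_power (a j) t \<in> M"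
      unfolding act[symmetric] by (rule diff_act.subspace_scale[OF subM])
    \<comment> \<open>This scalar cancels the nonzero factor \<open>\<alpha> j * c (a j)\<close> and
      turns the divided power back into \<open>L j ^ t\<close>.\<close>
    then have "Const (fact t / (\<alpha> j * c (a j))) * (Const (\<alpha> j * c (a j)) * divided_power (a j) t) \<in> M"
      by (rule subspace_Const_mult[OF subM])
    moreover have "fact t / (\<alpha> j * c (a j)) * (\<alpha> j * c (a j)) = fact t"
      using f(1) assms(10)[OF j] by simp
    ultimately show ?thesis
      unfolding L linear_form_power_eq_divided_power
      by (metis mult.assoc Const_simps(4))
  qed
  then have "generated_submodule ?N \<subseteq> M"
    by (intro diff_act.span_minimal[OF _ subM]) auto
  ultimately have M: "M = generated_submodule ?N" by blast
  \<comment> \<open>By the first claim and \<open>Ann_span\<close>, annihilating \<open>M\<close>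
    means annihilating the powers of the linear forms.\<close>
  moreover have "vanishing_ideal X = Ann M"
    using vanishing_ideal_eq_Ann[of "{1..r}" P a] P a
    unfolding M Ann_span assms(5) L by blast
  ultimately show ?thesis by blast
qed

end
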